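(* Binary concatenation is definable in the first-order theory $T_1$ of the structure $\mathfrak{S}_1=\langle\Sigma^*,1,2,\sqsubseteq,\sqsupseteq\rangle$; that is, there is a first-order formula $\varphi(x,y,z)$ in the vocabulary $\{\underline{1},\underline{2},\sqsubseteq,\sqsupseteq\}$ such that for all $r,s,t\in\Sigma^*$, $\mathfrak{S}_1\models\varphi(r,s,t)$ if and only if $r^\frown s=t$.
   Context: $\Sigma^*$ is the set of finite words over the alphabet $\{1,2\}$, including the empty word; $^\frown$ is concatenation of words. The constants $\underline{1},\underline{2}$ denote the one-letter words $1,2$. $s\sqsubseteq t$ means that $s$ is an initial segment of $t$ ($t=s^\frown u$ for some $u\in\Sigma^*$), and $s\sqsupseteq t$ means that $s$ is an end segment of $t$ ($t=u^\frown s$ for some $u\in\Sigma^*$). Formulas are first-order with equality. *)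

theory Defs
  imports Main "HOL-Library.Sublist"
begin

text \<open>Terms and first-order formulas with equality over the vocabulary consisting of two
  constant symbols and two binary relation symbols. Variables are named by natural numbers.\<close>

datatype trm = Var nat | Const1 | Const2

datatype form =
    Eq trm trm
  | Init trm trm
  | End trm trm
  | Neg form
  | Conj form form
  | Disj form form
  | Impl form form
  | Forall nat form
  | Exists nat form

fun fv_trm :: "trm \<Rightarrow> nat set" where
  "fv_trm (Var n) = {n}"
| "fv_trm Const1 = {}"
| "fv_trm Const2 = {}"

fun fv :: "form \<Rightarrow> nat set" where
  "fv (Eq a b) = fv_trm a \<union> fv_trm b"
| "fv (Init a b) = fv_trm a \<union> fv_trm b"
| "fv (End a b) = fv_trm a \<union> fv_trm b"
| "fv (Neg p) = fv p"
| "fv (Conj p q) = fv p \<union> fv q"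
| "fv (Disj p q) = fv p \<union> fv q"
| "fv (Impl p q) = fv p \<union> fv q"
| "fv (Forall n p) = fv p - {n}"
| "fv (Exists n p) = fv p - {n}"

text \<open>A structure for this vocabulary; its universe is the whole type \<open>'a\<close>.\<close>

record 'a struc =
  const1 :: 'a
  const2 :: 'a
  init_rel :: "'a \<Rightarrow> 'a \<Rightarrow> bool"
  end_rel :: "'a \<Rightarrow> 'a \<Rightarrow> bool"

fun eval_trm :: "'a struc \<Rightarrow> (nat \<Rightarrow> 'a) \<Rightarrow> trm \<Rightarrow> 'a" where
  "eval_trm M v (Var n) = v n"
| "eval_trm M v Const1 = const1 M"
| "eval_trm M v Const2 = const2 M"

fun sat :: "'a struc \<Rightarrow> (nat \<Rightarrow> 'a) \<Rightarrow> form \<Rightarrow> bool" where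
  "sat M v (Eq a b) \<longleftrightarrow> eval_trm M v a = eval_trm M v b"
| "sat M v (Init a b) \<longleftrightarrow> init_rel M (eval_trm M v a) (eval_trm M v b)"
| "sat M v (End a b) \<longleftrightarrow> end_rel M (eval_trm M v a) (eval_trm M v b)"
| "sat M v (Neg p) \<longleftrightarrow> \<not> sat M v p"
| "sat M v (Conj p q) \<longleftrightarrow> sat M v p \<and> sat M v q"
| "sat M v (Disj p q) \<longleftrightarrow> sat M v p \<or> sat M v q"
| "sat M v (Impl p q) \<longleftrightarrow> (sat M v p \<longrightarrow> sat M v q)"
| "sat M v (Forall n p) \<longleftrightarrow> (\<forall>a. sat M (v(n := a)) p)"
| "sat M v (Exists n p) \<longleftrightarrow> (\<exists>a. sat M (v(n := a)) p)"

datatype letter = L1 | L2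

type_synonym word = "letter list"

text \<open>In \<open>HOL-Library.Sublist\<close>, \<open>prefix s t\<close> says that \<open>t = s @ u\<close> for some \<open>u\<close>, and
  \<open>suffix s t\<close> that \<open>t = u @ s\<close> for some \<open>u\<close>.\<close>

definition S1 :: "word struc" where
  "S1 = \<lparr>const1 = [L1], const2 = [L2], init_rel = prefix, end_rel = suffix\<rparr>"

end

theory Submission
  imports Defs
begin

text \<open>
  A word \<open>W\<close> can encode a finite set of pairs of words: each pair \<open>(x, y)\<close> contributes the
  consecutive items \<open>2 1 x 2\<close> and \<open>2 2 y 2\<close>, and items are separated by a block \<open>1\<^sup>k\<close> longer than
  every item. That \<open>(x, y)\<close> belongs to the encoded set is expressible with initial and end
  segments alone. Now \<open>r\<^sup>\<frown>s = t\<close> holds iff every encoded set that contains \<open>(r, s)\<close> and is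
  closed under the moves \<open>(x, c\<^sup>\<frown>y) \<mapsto> (x\<^sup>\<frown>c, y)\<close> contains \<open>(t, \<epsilon>)\<close>: closure leads from \<open>(r, s)\<close> to
  \<open>(r\<^sup>\<frown>s, \<epsilon>)\<close>, and the set of all splits of \<open>r\<^sup>\<frown>s\<close> is one of the closed encoded sets.
\<close>

section \<open>Separated lists of items\<close>

definition separated :: "word \<Rightarrow> word list \<Rightarrow> word" where
  "separated S zs = concat (map (\<lambda>z. S @ z) zs) @ S"

lemma separated_Nil [simp]: "separated S [] = S"
  by (simp add: separated_def)

lemma separated_Cons [simp]: "separated S (z # zs) = S @ z @ separated S zs"
  by (simp add: separated_def)

lemma separated_eq_separator:
  assumes "separated S zs = S" and "\<And>z. z \<in> set zs \<Longrightarrow> z \<noteq> []"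
  shows "zs = []"
  using assms by (cases zs) auto

lemma separated_starts: "\<exists>d. separated S zs = S @ d"
  by (cases zs) simp_all

definition item :: "nat \<Rightarrow> word \<Rightarrow> bool" where
  "item k z \<longleftrightarrow> z \<noteq> [] \<and> hd z = L2 \<and> last z = L2 \<and> length z < k"

text \<open>Each end of an item is a 2, and no window of \<open>k\<close> letters beginning properly inside
  \<open>1\<^sup>k\<^sup>\<frown>z\<close> can avoid both of them.\<close>

lemma separator_occurrence_step:
  assumes S: "S = replicate k L1" and z: "item k z"
    and eq: "S @ z @ w = c @ S @ d" and "c \<noteq> []"
  shows "\<exists>c'. c = S @ z @ c' \<and> w = c' @ S @ d"
proof -
  have one: "(S @ z @ w) ! i = L1" if "length c \<le> i" "i < length c + k" for i
  proof -
    have "i - length c < k"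
      using that by linarith
    then show ?thesis
      unfolding eq using that by (simp add: nth_append S)
  qed
  have z': "z \<noteq> []" "z ! 0 = L2" "z ! (length z - 1) = L2" "length z < k"
    using z by (auto simp: item_def hd_conv_nth last_conv_nth)
  have two: "(S @ z @ w) ! k = L2" "(S @ z @ w) ! (k + (length z - 1)) = L2"
    using z' by (simp_all add: nth_append S)
  have "\<not> length c \<le> k"
    using one[of k] two(1) \<open>c \<noteq> []\<close> by auto
  moreover from this have "k + (length z - 1) < length c + k"
    using z'(4) by linarith
  then have "\<not> length c \<le> k + (length z - 1)"
    using one[of "k + (length z - 1)"] two(2) by fastforce
  ultimately have "length (S @ z) \<le> length c"
    using z' by (simp add: S)
  moreover have "(S @ z) @ w = c @ (S @ d)"
    using eq by simp
  ultimately have "c = (S @ z) @ drop (length (S @ z)) c"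
    by (metis append_eq_append_conv_if append_take_drop_id)
  then obtain c' where c': "c = S @ z @ c'"
    by (metis append.assoc)
  moreover from this have "w = c' @ S @ d"
    using eq by simp
  ultimately show ?thesis
    by blast
qed

text \<open>By \<open>separator_occurrence_step\<close>, an occurrence of \<open>S\<close> that is
  not at the very start lies wholly behind the first item, so induction peels off items until it is
  at the start. Hence \<open>S\<close> occurs only as a separator; both halves of the cut keep a
  copy of it.\<close>

lemma separator_occurrence:
  assumes S: "S = replicate k L1" and "\<forall>z\<in>set zs. item k z"
    and "separated S zs = c @ S @ d"
  shows "\<exists>zs1 zs2. zs = zs1 @ zs2 \<and> c @ S = separated S zs1 \<and> S @ d = separated S zs2"
  using assms(2,3)
proof (induction zs arbitrary: c)
  case Nil
  then have "length S = length (c @ S @ d)"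
    by simp
  then show ?case
    by simp
next
  case (Cons z zs)
  show ?case
  proof (cases "c = []")
    case True
    then have "c @ S = separated S []" "S @ d = separated S (z # zs)"
      using Cons.prems(2) by simp_all
    then show ?thesis
      by (metis append_Nil)
  next
    case False
    have "item k z" and eq: "S @ z @ separated S zs = c @ S @ d"
      using Cons.prems by simp_all
    from separator_occurrence_step[OF S this False]
    obtain c' where c': "c = S @ z @ c'" "separated S zs = c' @ S @ d"
      by blast
    have "\<forall>z\<in>set zs. item k z"
      using Cons.prems(1) by simp
    from Cons.IH[OF this c'(2)]
    obtain zs1 zs2 where zs: "zs = zs1 @ zs2" "c' @ S = separated S zs1" "S @ d = separated S zs2"
      by blast
    have "c @ S = separated S (z # zs1)"
      by (simp add: c'(1) zs(2))
    then show ?thesis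
      using zs by (metis append_Cons)
  qed
qed

text \<open>Here \<open>z\<close> and \<open>z'\<close> are arbitrary nonempty words, which might
  hide separators. The prefixes of \<open>u\<close> ending in \<open>S\<close> mark the occurrences
  of \<open>S\<close> in \<open>u\<close>; permitting only the three visible ones makes
  \<open>z\<close> and \<open>z'\<close> single items.\<close>

lemma consecutive_items_iff:
  fixes z z' :: word
  assumes S: "S = replicate k L1" and items: "\<forall>z\<in>set zs. item k z"
    and ne: "z \<noteq> []" "z' \<noteq> []"
  defines "u \<equiv> S @ z @ S @ z' @ S"
  shows "sublist u (separated S zs) \<and>
      (\<forall>p. prefix p u \<longrightarrow> suffix S p \<longrightarrow> p = S \<or> p = S @ z @ S \<or> p = u)
    \<longleftrightarrow> (\<exists>zs1 zs2. zs = zs1 @ [z, z'] @ zs2)"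
    (is "_ \<and> ?only \<longleftrightarrow> _")
proof
  assume asm: "sublist u (separated S zs) \<and> ?only"
  then obtain a b where "separated S zs = a @ S @ (z @ S @ z' @ S @ b)"
    by (auto simp: sublist_def u_def)
  \<comment> \<open>Cutting at the three visible separators of \<open>u\<close> in turn yields
    blocks \<open>zs3\<close> and \<open>zs5\<close> of items that spell out \<open>z\<close> and
    \<open>z'\<close>.\<close>
  from separator_occurrence[OF S items this]
  obtain zs1 zs2 where 1: "zs = zs1 @ zs2" "separated S zs2 = (S @ z) @ S @ (z' @ S @ b)"
    by auto
  have "\<forall>z\<in>set zs2. item k z"
    using items 1 by simp
  from separator_occurrence[OF S this 1(2)]
  obtain zs3 zs4 where 2: "zs2 = zs3 @ zs4" "S @ z @ S = separated S zs3"
    "separated S zs4 = (S @ z') @ S @ b"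
    by auto
  have "\<forall>z\<in>set zs4. item k z"
    using items 1 2 by simp
  from separator_occurrence[OF S this 2(3)]
  obtain zs5 zs6 where 3: "zs4 = zs5 @ zs6" "S @ z' @ S = separated S zs5"
    by auto
  have nonempty: "y \<noteq> []" if "y \<in> set zs" for y
    using items that by (auto simp: item_def)
  obtain z3 zs3' where z3: "zs3 = z3 # zs3'"
    using 2(2) ne by (cases zs3) auto
  obtain z5 zs5' where z5: "zs5 = z5 # zs5'"
    using 3(2) ne by (cases zs5) auto
  obtain d3 where d3: "separated S zs3' = S @ d3"
    using separated_starts by blast
  obtain d5 where d5: "separated S zs5' = S @ d5"
    using separated_starts by blast
  have "z3 \<noteq> []" "z5 \<noteq> []"
    using nonempty 1 2 3 z3 z5 by auto
  \<comment> \<open>The first item of \<open>zs3\<close> with the separators around it is a prefix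
    of \<open>u\<close> ending in \<open>S\<close>. Being longer than \<open>S\<close> and shorter
    than \<open>u\<close>, it is the second permitted prefix. Likewise the first item of
    \<open>zs5\<close> can only end where \<open>z'\<close> does.\<close>
  have e: "S @ z @ S = S @ z3 @ S @ d3"
    using 2(2) z3 d3 by simp
  then have "u = (S @ z3 @ S) @ d3 @ z' @ S"
    by (simp add: u_def)
  then have "prefix (S @ z3 @ S) u"
    by (metis prefixI)
  moreover have "suffix S (S @ z3 @ S)"
    by (simp add: suffix_def)
  ultimately have "S @ z3 @ S = S \<or> S @ z3 @ S = S @ z @ S \<or> S @ z3 @ S = u"
    using asm by blast
  moreover have "length (S @ z3 @ S) < length u"
    using arg_cong[OF e, of length] ne by (simp add: u_def)
  ultimately have zz3: "z = z3"
    using \<open>z3 \<noteq> []\<close> by auto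
  have e': "z' @ S = z5 @ S @ d5"
    using 3(2) z5 d5 by simp
  then have "u = (S @ z @ S @ z5 @ S) @ d5"
    by (simp add: u_def)
  then have "prefix (S @ z @ S @ z5 @ S) u"
    by (metis prefixI)
  moreover have "suffix S (S @ z @ S @ z5 @ S)"
    by (simp add: suffix_def)
  ultimately have "S @ z @ S @ z5 @ S = S \<or> S @ z @ S @ z5 @ S = S @ z @ S \<or> S @ z @ S @ z5 @ S = u"
    using asm by blast
  then have zz5: "z' = z5"
    using \<open>z5 \<noteq> []\<close> by (auto simp: u_def)
  have "d3 = []" "d5 = []"
    using e e' zz3 zz5 by simp_all
  then have "separated S zs3' = S" "separated S zs5' = S"
    using d3 d5 by simp_all
  moreover have "y \<noteq> []" if "y \<in> set zs3' \<union> set zs5'" for y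
    using nonempty that by (auto simp: 1 2 3 z3 z5)
  ultimately have "zs3' = []" "zs5' = []"
    using separated_eq_separator by auto
  then have "zs = zs1 @ [z, z'] @ zs6"
    using 1 2 3 z3 z5 zz3 zz5 by simp
  then show "\<exists>zs1 zs2. zs = zs1 @ [z, z'] @ zs2"
    by blast
next
  assume "\<exists>zs1 zs2. zs = zs1 @ [z, z'] @ zs2"
  then obtain zs1 zs2 where zs: "zs = zs1 @ [z, z'] @ zs2"
    by blast
  obtain d where "separated S zs2 = S @ d"
    using separated_starts by blast
  then have "separated S zs = concat (map (\<lambda>z. S @ z) zs1) @ u @ d"
    by (simp add: separated_def zs u_def)
  then have "sublist u (separated S zs)"
    by (metis sublist_appendI)
  moreover have ?only
  proof (intro allI impI)
    fix p
    assume "prefix p u" "suffix S p"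
    then obtain c d where p: "p = c @ S" and "u = c @ S @ d"
      by (auto simp: prefix_def suffix_def)
    \<comment> \<open>A prefix of \<open>u\<close> ending in \<open>S\<close> is a cut of the list
      \<open>[z, z']\<close>, which has only three cuts.\<close>
    then have "separated S [z, z'] = c @ S @ d"
      by (simp add: u_def)
    moreover have "\<forall>y\<in>set [z, z']. item k y"
      using items zs by simp
    ultimately obtain ys1 ys2 where "[z, z'] = ys1 @ ys2" "p = separated S ys1"
      using separator_occurrence[OF S, of "[z, z']" c d] unfolding p by blast
    then have "ys1 = [] \<or> ys1 = [z] \<or> ys1 = [z, z']"
      by (auto simp: Cons_eq_append_conv)
    then show "p = S \<or> p = S @ z @ S \<or> p = u"
      using \<open>p = separated S ys1\<close> by (auto simp: u_def)
  qed
  ultimately show "sublist u (separated S zs) \<and> ?only"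
    by blast
qed

section \<open>Membership in the encoded set\<close>

text \<open>The prefixes of \<open>z @ h\<close> that are not prefixes of \<open>z\<close> end, one
  by one, at the letters of \<open>h\<close>. So initial and end segments suffice to say that
  \<open>h\<close> is a run of \<open>c\<close>; \<open>suffix_run_iff\<close> is the mirror
  image.\<close>

lemma prefix_run_iff:
  "(\<forall>p. prefix p (z @ h) \<longrightarrow> prefix p z \<or> suffix [c] p) \<longleftrightarrow> set h \<subseteq> {c}"
proof (induction h rule: rev_induct)
  case Nil
  then show ?case by simp
next
  case (snoc a h)
  have "prefix p (z @ h @ [a]) \<longleftrightarrow> p = z @ h @ [a] \<or> prefix p (z @ h)" for p
    using prefix_snoc[of p "z @ h" a] by simp
  moreover have "\<not> prefix (z @ h @ [a]) z"
    by (auto dest: prefix_length_le)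
  moreover have "suffix [c] (z @ h @ [a]) \<longleftrightarrow> a = c"
    by (metis append.assoc append_is_Nil_conv last_snoc snoc_suffix_snoc suffix_bot.extremum
        self_append_conv2)
  ultimately show ?case
    using snoc.IH by auto
qed

lemma suffix_run_iff:
  "(\<forall>p. suffix p (h @ z) \<longrightarrow> suffix p z \<or> prefix [c] p) \<longleftrightarrow> set h \<subseteq> {c}"
proof (induction h)
  case Nil
  then show ?case by simp
next
  case (Cons a h)
  have "\<not> suffix (a # h @ z) z"
    by (auto dest: suffix_length_le)
  then show ?case
    using Cons.IH by (auto simp: suffix_Cons)
qed

lemma replicate_run_eq:
  assumes "a \<noteq> b" and "replicate i a @ b # x = replicate j a @ b # y"
  shows "i = j"
  using assms(2)
proof (induction i arbitrary: j)
  case 0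
  then show ?case using assms(1) by (cases j) auto
next
  case (Suc i)
  then show ?case using assms(1) by (cases j) auto
qed

text \<open>For \<open>P = 2\<^sup>\<frown>1\<^sup>k\<close> and \<open>P' = 1\<^sup>k\<^sup>\<frown>2\<close> this says \<open>e = 1\<^sup>k\<^sup>\<frown>z\<^sup>\<frown>1\<^sup>k\<close>.\<close>

definition framed :: "word \<Rightarrow> word \<Rightarrow> word \<Rightarrow> word \<Rightarrow> bool" where
  "framed P P' z e \<longleftrightarrow> prefix P' e \<and> suffix P e \<and>
    (\<exists>g. suffix g e \<and> prefix z g \<and> (\<forall>p. prefix p g \<longrightarrow> prefix p z \<or> suffix [L1] p) \<and>
      (\<forall>p. suffix p e \<longrightarrow> suffix p g \<or> prefix [L1] p))"

text \<open>The two run conditions make \<open>e\<close> the word \<open>z\<close> between two runs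
  of 1. As \<open>z\<close> begins and ends with 2, the prefix \<open>S @ [L2]\<close> and the
  suffix \<open>L2 # S\<close> fix the lengths of these runs.\<close>

lemma framed_iff:
  assumes S: "S = replicate k L1" and z: "z = L2 # x @ [L2]"
  shows "framed (L2 # S) (S @ [L2]) z e \<longleftrightarrow> e = S @ z @ S"
proof
  assume f: "framed (L2 # S) (S @ [L2]) z e"
  then obtain g where g: "suffix g e" "prefix z g"
    "\<forall>p. prefix p g \<longrightarrow> prefix p z \<or> suffix [L1] p"
    "\<forall>p. suffix p e \<longrightarrow> suffix p g \<or> prefix [L1] p"
    unfolding framed_def by blast
  then obtain h h' where h: "g = z @ h" "e = h' @ g"
    by (auto simp: prefix_def suffix_def)
  have "set h \<subseteq> {L1}" "set h' \<subseteq> {L1}"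
    using g(3,4) unfolding h prefix_run_iff suffix_run_iff .
  then obtain i j where ij: "h = replicate i L1" "h' = replicate j L1"
    by (metis replicate_length_same singletonD subsetD)
  have e: "e = replicate j L1 @ L2 # x @ L2 # replicate i L1"
    by (simp add: h ij z)
  have "prefix (S @ [L2]) e" "suffix (L2 # S) e"
    using f by (simp_all add: framed_def)
  then obtain c d where c: "e = (S @ [L2]) @ c" and d: "e = d @ L2 # S"
    unfolding prefix_def suffix_def by blast
  have "replicate j L1 @ L2 # x @ L2 # replicate i L1 = replicate k L1 @ L2 # c"
    using c e S by simp
  then have "j = k"
    by (rule replicate_run_eq[rotated]) simp
  \<comment> \<open>Reversal turns the final run into an initial one, to which
    \<open>replicate_run_eq\<close> applies again.\<close>
  have "rev e = replicate k L1 @ L2 # rev d"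
    by (simp add: d S)
  moreover have "rev e = replicate i L1 @ L2 # rev x @ L2 # replicate j L1"
    by (simp add: e)
  ultimately have "replicate i L1 @ L2 # rev x @ L2 # replicate j L1 = replicate k L1 @ L2 # rev d"
    by simp
  then have "i = k"
    by (rule replicate_run_eq[rotated]) simp
  then show "e = S @ z @ S"
    using \<open>j = k\<close> by (simp add: e S z)
next
  assume e: "e = S @ z @ S"
  have "set S \<subseteq> {L1}"
    by (auto simp: S)
  then have "suffix (z @ S) e \<and> prefix z (z @ S) \<and>
      (\<forall>p. prefix p (z @ S) \<longrightarrow> prefix p z \<or> suffix [L1] p) \<and>
      (\<forall>p. suffix p e \<longrightarrow> suffix p (z @ S) \<or> prefix [L1] p)"
    unfolding e prefix_run_iff suffix_run_iff by (simp add: suffix_def)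
  moreover have "prefix (S @ [L2]) e" "suffix (L2 # S) e"
    by (simp_all add: e z suffix_def)
  ultimately show "framed (L2 # S) (S @ [L2]) z e"
    unfolding framed_def by blast
qed

text \<open>The letter \<open>c\<close> tells first from second components; the outer 2s give the
  shape of an item.\<close>

definition tagged :: "letter \<Rightarrow> word \<Rightarrow> word" where
  "tagged c x = L2 # c # x @ [L2]"

text \<open>Without concatenation, \<open>u\<close> is described by overlapping frames
  \<open>e\<close> and \<open>e'\<close>. For the intended parameters the last clause has two tasks:
  with \<open>u \<noteq> e'\<close> it makes the overlap exactly one separator, and it excludes
  separators hidden inside the two items.\<close>

definition encoded :: "word \<Rightarrow> word \<Rightarrow> word \<Rightarrow> word \<Rightarrow> word \<Rightarrow> word \<Rightarrow> bool" where
  "encoded W S P P' x y \<longleftrightarrow> (\<exists>e e' u. framed P P' (tagged L1 x) e \<and> framed P P' (tagged L2 y) e' \<and>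
    prefix e u \<and> suffix e' u \<and> u \<noteq> e' \<and> sublist u W \<and>
    (\<forall>p. prefix p u \<longrightarrow> suffix S p \<longrightarrow> p = S \<or> p = e \<or> p = u))"

lemma encoded_iff:
  fixes x y :: word
  assumes S: "S = replicate k L1"
  defines "u \<equiv> S @ tagged L1 x @ S @ tagged L2 y @ S"
  shows "encoded W S (L2 # S) (S @ [L2]) x y \<longleftrightarrow> sublist u W \<and>
    (\<forall>p. prefix p u \<longrightarrow> suffix S p \<longrightarrow> p = S \<or> p = S @ tagged L1 x @ S \<or> p = u)"
    (is "_ \<longleftrightarrow> ?R")
proof -
  let ?e = "S @ tagged L1 x @ S" and ?e' = "S @ tagged L2 y @ S"
  have fr: "framed (L2 # S) (S @ [L2]) (tagged c x) e \<longleftrightarrow> e = S @ tagged c x @ S" for c x e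
    by (rule framed_iff[OF S, where x = "c # x"]) (simp add: tagged_def)
  show ?thesis
  proof
    assume "encoded W S (L2 # S) (S @ [L2]) x y"
    then obtain w where w: "suffix ?e' w" "w \<noteq> ?e'" "sublist w W"
      "\<forall>p. prefix p w \<longrightarrow> suffix S p \<longrightarrow> p = S \<or> p = ?e \<or> p = w"
      unfolding encoded_def fr by blast
    then obtain d where d: "w = d @ ?e'"
      by (auto simp: suffix_def)
    \<comment> \<open>This prefix ends with the first separator of \<open>?e'\<close>. It is too
      short to be \<open>w\<close>, and it is not \<open>S\<close> because
      \<open>w \<noteq> ?e'\<close>; so it is \<open>?e\<close>.\<close>
    have "prefix (d @ S) w" "suffix S (d @ S)"
      by (simp_all add: d suffix_def)
    then have "d @ S = S \<or> d @ S = ?e \<or> d @ S = w"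
      using w(4) by blast
    then have "d @ S = ?e"
      using d w(2) by (auto simp: tagged_def)
    then have "w = u"
      using d by (simp add: u_def)
    then show ?R
      using w by simp
  next
    assume ?R
    moreover have "prefix ?e u" "suffix ?e' u" "u \<noteq> ?e'"
      by (auto simp: u_def suffix_def prefix_def tagged_def)
    ultimately show "encoded W S (L2 # S) (S @ [L2]) x y"
      unfolding encoded_def fr by blast
  qed
qed

section \<open>Lists of pairs as lists of items, and the splits of a word\<close>

definition pair_items :: "(word \<times> word) list \<Rightarrow> word list" where
  "pair_items ps = concat (map (\<lambda>(x, y). [tagged L1 x, tagged L2 y]) ps)"

text \<open>The tags alternate along the list, so an item tagged 1 and the item tagged 2 right after
  it never straddle two pairs.\<close>

lemma consecutive_pair_items_iff:
  "(\<exists>zs1 zs2. pair_items ps = zs1 @ [tagged L1 x, tagged L2 y] @ zs2) \<longleftrightarrow> (x, y) \<in> set ps"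
proof
  assume "\<exists>zs1 zs2. pair_items ps = zs1 @ [tagged L1 x, tagged L2 y] @ zs2"
  then obtain zs1 zs2 where "pair_items ps = zs1 @ [tagged L1 x, tagged L2 y] @ zs2"
    by blast
  then show "(x, y) \<in> set ps"
  proof (induction ps arbitrary: zs1)
    case Nil
    then show ?case by (simp add: pair_items_def)
  next
    case (Cons q ps)
    obtain a b where q: "q = (a, b)"
      by fastforce
    have eq: "tagged L1 a # tagged L2 b # pair_items ps = zs1 @ [tagged L1 x, tagged L2 y] @ zs2"
      using Cons.prems by (simp add: pair_items_def q)
    consider "zs1 = []" | z where "zs1 = [z]" | z z' zs where "zs1 = z # z' # zs"
      by (metis neq_Nil_conv)
    then show ?case
    proof cases
      case 1
      then show ?thesis using eq by (simp add: tagged_def q)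
    next
      case 2
      then show ?thesis using eq by (simp add: tagged_def)
    next
      case 3
      then show ?thesis using eq Cons.IH by simp
    qed
  qed
next
  assume "(x, y) \<in> set ps"
  then obtain ps1 ps2 where "ps = ps1 @ (x, y) # ps2"
    by (meson split_list)
  then have "pair_items ps = pair_items ps1 @ [tagged L1 x, tagged L2 y] @ pair_items ps2"
    by (simp add: pair_items_def)
  then show "\<exists>zs1 zs2. pair_items ps = zs1 @ [tagged L1 x, tagged L2 y] @ zs2"
    by blast
qed

lemma splits_encodable:
  "\<exists>W S P P'. \<forall>x y. encoded W S P P' x y \<longleftrightarrow> x @ y = w"
proof -
  \<comment> \<open>Tagging adds three letters, so every item has at most
    \<open>length w + 3\<close> letters.\<close>
  define k where "k = length w + 4"
  define S where "S = replicate k L1"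
  define ps where "ps = map (\<lambda>i. (take i w, drop i w)) [0..<Suc (length w)]"
  have ps: "(x, y) \<in> set ps \<longleftrightarrow> x @ y = w" for x y
  proof
    assume "x @ y = w"
    then have "(x, y) = (take (length x) w, drop (length x) w)" "length x < Suc (length w)"
      by auto
    then show "(x, y) \<in> set ps"
      unfolding ps_def set_map set_upt by (intro image_eqI[where x = "length x"]) simp_all
  qed (auto simp: ps_def)
  have items: "\<forall>z\<in>set (pair_items ps). item k z"
    by (auto simp: pair_items_def ps item_def tagged_def k_def)
  have "encoded (separated S (pair_items ps)) S (L2 # S) (S @ [L2]) x y \<longleftrightarrow> x @ y = w" for x y
    using consecutive_items_iff[OF S_def items, of "tagged L1 x" "tagged L2 y"]
      consecutive_pair_items_iff[of ps x y] ps[of x y]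
    unfolding encoded_iff[OF S_def] by (simp add: tagged_def)
  then show ?thesis
    by blast
qed

section \<open>The defining formula\<close>

text \<open>From left to right the parameters may be arbitrary, so no clause has to say that they
  fit together. From right to left one good choice is enough.\<close>

lemma append_iff_closed:
  "r @ s = t \<longleftrightarrow> (\<forall>W S P P'. encoded W S P P' r s \<longrightarrow>
    (\<forall>x y c. encoded W S P P' x (c # y) \<longrightarrow> encoded W S P P' (x @ [c]) y) \<longrightarrow>
    encoded W S P P' t [])"
    (is "_ \<longleftrightarrow> ?R")
proof
  assume t: "r @ s = t"
  show ?R
  proof (intro allI impI)
    fix W S P P'
    assume "encoded W S P P' r s"
      and move: "\<forall>x y c. encoded W S P P' x (c # y) \<longrightarrow> encoded W S P P' (x @ [c]) y"
    then have "encoded W S P P' (r @ s) []"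
    proof (induction s arbitrary: r)
      case Nil
      then show ?case by simp
    next
      case (Cons c s)
      then have "encoded W S P P' ((r @ [c]) @ s) []"
        by blast
      then show ?case by simp
    qed
    then show "encoded W S P P' t []"
      by (simp add: t)
  qed
next
  assume R: ?R
  obtain W S P P' where enc: "\<And>x y. encoded W S P P' x y \<longleftrightarrow> x @ y = r @ s"
    using splits_encodable by blast
  \<comment> \<open>The splits of \<open>r @ s\<close> include \<open>(r, s)\<close> and are closed
    under moves by associativity.\<close>
  have "encoded W S P P' t []"
    using R[rule_format, of W S P P'] unfolding enc by simp
  then show "r @ s = t"
    by (simp add: enc)
qed

section \<open>Translation into first-order formulas\<close>

fun ltr :: "letter \<Rightarrow> trm" where
  "ltr L1 = Const1"
| "ltr L2 = Const2"

lemma S1_simps [simp]: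
  "const1 S1 = [L1]" "const2 S1 = [L2]" "init_rel S1 = prefix" "end_rel S1 = suffix"
  by (simp_all add: S1_def)

lemma eval_ltr [simp]: "eval_trm S1 v (ltr c) = [c]"
  by (cases c) simp_all

lemma fv_ltr [simp]: "fv_trm (ltr c) = {}"
  by (cases c) simp_all

text \<open>In the formulas below, the arguments \<open>a, b, g, n\<close> and the variables from 20 on are bound,
  so they have to differ from the other arguments.\<close>

definition snoc_form :: "letter \<Rightarrow> nat \<Rightarrow> nat \<Rightarrow> nat \<Rightarrow> form" where
  "snoc_form c x w n = Conj (Init (Var x) (Var w)) (Conj (Neg (Eq (Var x) (Var w)))
    (Conj (End (ltr c) (Var w))
      (Forall n (Impl (Init (Var n) (Var w)) (Disj (Init (Var n) (Var x)) (Eq (Var n) (Var w)))))))"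

definition cons_form :: "letter \<Rightarrow> nat \<Rightarrow> nat \<Rightarrow> nat \<Rightarrow> form" where
  "cons_form c x w n = Conj (End (Var x) (Var w)) (Conj (Neg (Eq (Var x) (Var w)))
    (Conj (Init (ltr c) (Var w))
      (Forall n (Impl (End (Var n) (Var w)) (Disj (End (Var n) (Var x)) (Eq (Var n) (Var w)))))))"

definition framed_form :: "nat \<Rightarrow> nat \<Rightarrow> nat \<Rightarrow> nat \<Rightarrow> nat \<Rightarrow> nat \<Rightarrow> form" where
  "framed_form P P' z e g n = Conj (Init (Var P') (Var e)) (Conj (End (Var P) (Var e))
    (Exists g (Conj (End (Var g) (Var e)) (Conj (Init (Var z) (Var g)) (Conj
      (Forall n (Impl (Init (Var n) (Var g)) (Disj (Init (Var n) (Var z)) (End Const1 (Var n)))))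
      (Forall n (Impl (End (Var n) (Var e)) (Disj (End (Var n) (Var g)) (Init Const1 (Var n))))))))))"

definition tagged_form :: "letter \<Rightarrow> nat \<Rightarrow> nat \<Rightarrow> nat \<Rightarrow> nat \<Rightarrow> nat \<Rightarrow> form" where
  "tagged_form c x z a b n = Exists a (Exists b (Conj (cons_form c x a n)
    (Conj (cons_form L2 a b n) (snoc_form L2 b z n))))"

text \<open>The parameters \<open>W, S, P, P'\<close> are the variables 3, 4, 5, 6.\<close>

definition encoded_form :: "nat \<Rightarrow> nat \<Rightarrow> form" where
  "encoded_form x y = Exists 20 (Exists 21 (Exists 22 (Exists 23 (Exists 24 (
    Conj (tagged_form L1 x 20 25 26 27) (Conj (tagged_form L2 y 21 25 26 27) (
    Conj (framed_form 5 6 20 22 25 26) (Conj (framed_form 5 6 21 23 25 26) (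
    Conj (Init (Var 22) (Var 24)) (Conj (End (Var 23) (Var 24)) (
    Conj (Neg (Eq (Var 24) (Var 23))) (
    Conj (Exists 25 (Conj (Init (Var 25) (Var 3)) (End (Var 24) (Var 25))))
      (Forall 25 (Impl (Init (Var 25) (Var 24)) (Impl (End (Var 4) (Var 25))
        (Disj (Eq (Var 25) (Var 4)) (Disj (Eq (Var 25) (Var 22)) (Eq (Var 25) (Var 24)))))))))))))))))))"

text \<open>Variables range over words, not letters, hence one disjunct per letter. Variables 7, 8,
  9, 10 stand for \<open>x\<close>, \<open>c # y\<close>, \<open>x @ [c]\<close>,
  \<open>y\<close>.\<close>

definition closed_form :: form where
  "closed_form = Forall 7 (Forall 8 (Forall 9 (Forall 10 (Impl (encoded_form 7 8) (Impl
    (Disj (Conj (snoc_form L1 7 9 11) (cons_form L1 10 8 11))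
          (Conj (snoc_form L2 7 9 11) (cons_form L2 10 8 11)))
    (encoded_form 9 10))))))"

text \<open>The vocabulary has no constant for the empty word; variable 7 is made empty by being an
  initial segment of every word.\<close>

definition append_form :: form where
  "append_form = Forall 3 (Forall 4 (Forall 5 (Forall 6 (Impl (encoded_form 0 1) (Impl closed_form
    (Forall 7 (Impl (Forall 8 (Init (Var 7) (Var 8))) (encoded_form 2 7))))))))"

text \<open>Appending one letter means being an immediate successor in the prefix order: a longer
  remainder would leave a proper prefix of \<open>w\<close> strictly beyond
  \<open>x\<close>.\<close>

lemma snoc_iff:
  "w = x @ [c] \<longleftrightarrow> prefix x w \<and> x \<noteq> w \<and> suffix [c] w \<and> (\<forall>p. prefix p w \<longrightarrow> prefix p x \<or> p = w)"
    (is "_ \<longleftrightarrow> ?R")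
proof
  assume R: ?R
  then obtain h where w: "w = x @ h" and "h \<noteq> []"
    by (auto simp: prefix_def)
  then obtain a h' where h: "h = a # h'"
    by (cases h) auto
  have "prefix (x @ [a]) w" "\<not> prefix (x @ [a]) x"
    by (auto simp: w h dest: prefix_length_le)
  then have "w = x @ [a]"
    using R by blast
  moreover from this have "a = c"
    using R by (auto simp: suffix_def)
  ultimately show "w = x @ [c]"
    by simp
qed (auto simp: suffix_def)

lemma cons_iff:
  "w = c # x \<longleftrightarrow> suffix x w \<and> x \<noteq> w \<and> prefix [c] w \<and> (\<forall>p. suffix p w \<longrightarrow> suffix p x \<or> p = w)"
    (is "_ \<longleftrightarrow> ?R")
proof
  assume R: ?R
  then obtain h where w: "w = h @ x" and "h \<noteq> []"
    by (auto simp: suffix_def)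
  then obtain a h' where h: "h = h' @ [a]"
    by (cases h rule: rev_cases) auto
  have "suffix (a # x) w" "\<not> suffix (a # x) x"
    by (auto simp: w h suffix_def dest: arg_cong[where f = length])
  then have "w = a # x"
    using R by blast
  moreover from this have "a = c"
    using R by simp
  ultimately show "w = c # x"
    by simp
qed (auto simp: suffix_Cons)

section \<open>Meaning of the formulas in the word structure\<close>

lemma sat_snoc_form [simp]:
  "n \<noteq> x \<Longrightarrow> n \<noteq> w \<Longrightarrow> sat S1 v (snoc_form c x w n) \<longleftrightarrow> v w = v x @ [c]"
  unfolding snoc_iff by (simp add: snoc_form_def)

lemma sat_cons_form [simp]:
  "n \<noteq> x \<Longrightarrow> n \<noteq> w \<Longrightarrow> sat S1 v (cons_form c x w n) \<longleftrightarrow> v w = c # v x"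
  unfolding cons_iff by (simp add: cons_form_def)

lemma sat_framed_form [simp]:
  "n \<notin> {z, e, g} \<Longrightarrow> g \<notin> {z, e} \<Longrightarrow>
    sat S1 v (framed_form P P' z e g n) \<longleftrightarrow> framed (v P) (v P') (v z) (v e)"
  by (simp add: framed_form_def framed_def)

lemma sat_tagged_form [simp]:
  assumes "distinct [x, z, a, b, n]"
  shows "sat S1 v (tagged_form c x z a b n) \<longleftrightarrow> v z = tagged c (v x)"
proof -
  have "n \<noteq> x" "n \<noteq> z" "n \<noteq> a" "n \<noteq> b" "a \<noteq> x" "a \<noteq> z" "a \<noteq> b" "b \<noteq> x" "b \<noteq> z"
    using assms by auto
  then show ?thesis
    by (simp add: tagged_form_def tagged_def)
qed

text \<open>The bounds on \<open>x\<close> and \<open>y\<close> prevent capture. Variables 20 and 21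
  hold the tagged words, 22 and 23 their frames, 24 the word \<open>u\<close>; being a factor of
  \<open>W\<close> is rendered as being an end segment of an initial segment.\<close>

lemma sat_encoded_form [simp]:
  "x < 20 \<Longrightarrow> y < 20 \<Longrightarrow>
    sat S1 v (encoded_form x y) \<longleftrightarrow> encoded (v 3) (v 4) (v 5) (v 6) (v x) (v y)"
  by (simp add: encoded_form_def encoded_def sublist_altdef)

lemma sat_closed_form [simp]:
  "sat S1 v closed_form \<longleftrightarrow> (\<forall>x y c. encoded (v 3) (v 4) (v 5) (v 6) x (c # y) \<longrightarrow>
    encoded (v 3) (v 4) (v 5) (v 6) (x @ [c]) y)"
proof -
  have all_letter: "(\<forall>c. Q c) \<longleftrightarrow> Q L1 \<and> Q L2" for Q :: "letter \<Rightarrow> bool"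
    by (metis letter.exhaust)
  show ?thesis
    unfolding all_letter by (simp add: closed_form_def) blast
qed

lemma sat_append_form: "sat S1 v append_form \<longleftrightarrow> v 0 @ v 1 = v 2"
proof -
  have nil: "(\<forall>a::word. prefix w a) \<longleftrightarrow> w = []" for w
    by (metis prefix_Nil Nil_prefix)
  show ?thesis
    unfolding append_iff_closed by (simp add: append_form_def nil)
qed

section \<open>Free variables of the formulas\<close>

lemma fv_snoc_form [simp]: "n \<noteq> x \<Longrightarrow> n \<noteq> w \<Longrightarrow> fv (snoc_form c x w n) = {x, w}"
  by (auto simp: snoc_form_def)

lemma fv_cons_form [simp]: "n \<noteq> x \<Longrightarrow> n \<noteq> w \<Longrightarrow> fv (cons_form c x w n) = {x, w}"
  by (auto simp: cons_form_def)

lemma fv_framed_form [simp]: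
  "n \<notin> {z, e, g} \<Longrightarrow> g \<notin> {z, e} \<Longrightarrow> fv (framed_form P P' z e g n) = {P, P', z, e}"
  by (auto simp: framed_form_def)

lemma fv_tagged_form [simp]:
  "distinct [x, z, a, b, n] \<Longrightarrow> fv (tagged_form c x z a b n) = {x, z}"
  by (auto simp: tagged_form_def)

lemma fv_encoded_form: "x < 20 \<Longrightarrow> y < 20 \<Longrightarrow> fv (encoded_form x y) \<subseteq> {3, 4, 5, 6, x, y}"
  by (simp add: encoded_form_def) blast

lemma fv_closed_form: "fv closed_form \<subseteq> {3, 4, 5, 6}"
  using fv_encoded_form[of 7 8] fv_encoded_form[of 9 10]
  by (simp add: closed_form_def subset_iff) blast

lemma fv_append_form: "fv append_form \<subseteq> {0, 1, 2}"
  using fv_closed_form fv_encoded_form[of 0 1] fv_encoded_form[of 2 7]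
  by (simp add: append_form_def subset_iff) blast

theorem theorem9p2:
  shows "\<exists>\<phi>. fv \<phi> \<subseteq> {0, 1, 2} \<and>
    (\<forall>(r::word) (s::word) (t::word) (v::nat \<Rightarrow> word).
      sat S1 (v(0 := r, 1 := s, 2 := t)) \<phi> \<longleftrightarrow> r @ s = t)"
  by (intro exI[of _ append_form] conjI fv_append_form) (simp add: sat_append_form)

end
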